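(* Let $\mathcal H$ be a complex Hilbert space and let $(T_1,T_2)$ be a pair of commuting bounded linear operators on $\mathcal H$ with $\|T_1\|<1$ and $\|T_2\|<1$. Then $(T_1,T_2)$ admits a minimal isometric dilation on the Hilbert space $\mathcal H\oplus_2 \ell_2(\mathcal H\oplus_2\mathcal H)$. That is, there exist commuting isometries $V_1,V_2$ on $\mathcal K=\mathcal H\oplus_2 \ell_2(\mathcal H\oplus_2\mathcal H)$ (where $\mathcal H$ is identified with the subspace $\{(h,\mathbf 0,\mathbf 0,\dots)\}$) such that $P_{\mathcal H}V_1^{s_1}V_2^{s_2}h=T_1^{s_1}T_2^{s_2}h$ for all $h\in\mathcal H$ and all $s_1,s_2\in\mathbb N\cup\{0\}$, and $\mathcal K=\overline{\operatorname{span}}\{V_1^{s_1}V_2^{s_2}h: h\in\mathcal H,\ s_1,s_2\in\mathbb N\cup\{0\}\}$.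
   Context: For normed spaces $\mathbb X_1,\mathbb X_2$, the direct $2$-sum $\mathbb X_1\oplus_2\mathbb X_2$ is the space of pairs $(x_1,x_2)$ with norm $\|(x_1,x_2)\|=(\|x_1\|^2+\|x_2\|^2)^{1/2}$. For a normed space $\mathbb X$, $\ell_2(\mathbb X)$ is the space of sequences $(x_n)_{n\ge1}$ in $\mathbb X$ with $\sum\|x_n\|^2<\infty$, normed by $(\sum_n\|x_n\|^2)^{1/2}$. $P_{\mathcal H}$ denotes the orthogonal projection of $\mathcal K$ onto $\mathcal H$. All spaces are over $\mathbb C$ and all operators are bounded and linear. *)

theory Defs
  imports "HOL-Analysis.Analysis"
begin

class complex_vector = real_vector +
  fixes scaleC :: "complex \<Rightarrow> 'a \<Rightarrow> 'a"
  assumes scaleC_add_right: "scaleC a (x + y) = scaleC a x + scaleC a y"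
    and scaleC_add_left: "scaleC (a + b) x = scaleC a x + scaleC b x"
    and scaleC_scaleC: "scaleC a (scaleC b x) = scaleC (a * b) x"
    and scaleC_one: "scaleC 1 x = x"
    and scaleR_scaleC: "scaleR r x = scaleC (complex_of_real r) x"

class complex_inner = complex_vector + real_normed_vector +
  fixes cinner :: "'a \<Rightarrow> 'a \<Rightarrow> complex"
  assumes cinner_commute: "cinner x y = cnj (cinner y x)"
    and cinner_add_left: "cinner (x + y) z = cinner x z + cinner y z"
    and cinner_scaleC_left: "cinner (scaleC r x) y = cnj r * cinner x y"
    and cinner_ge_zero: "0 \<le> Re (cinner x x)"
    and cinner_eq_zero_iff: "cinner x x = 0 \<longleftrightarrow> x = 0"
    and norm_eq_sqrt_cinner: "norm x = sqrt (Re (cinner x x))"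

class chilbert_space = complex_inner + complete_space

definition clinear :: "('a::complex_vector \<Rightarrow> 'b::complex_vector) \<Rightarrow> bool" where
  "clinear f \<longleftrightarrow> (\<forall>x y. f (x + y) = f x + f y) \<and> (\<forall>c x. f (scaleC c x) = scaleC c (f x))"

definition bounded_clinear_op :: "('a::{complex_vector,real_normed_vector} \<Rightarrow> 'a) \<Rightarrow> bool" where
  "bounded_clinear_op T \<longleftrightarrow> clinear T \<and> (\<exists>K. \<forall>x. norm (T x) \<le> norm x * K)"

text \<open>Elements of K are pairs (h, f) with f a square-summable sequence in H \<oplus>_2 H.
The carrier is the set \<open>Kspace\<close>; operations are defined componentwise.\<close>

type_synonym 'h Kelem = "'h \<times> (nat \<Rightarrow> 'h \<times> 'h)"

definition Kspace :: "('h::real_normed_vector) Kelem set" where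
  "Kspace = {(h, f). summable (\<lambda>n. (norm (fst (f n)))\<^sup>2 + (norm (snd (f n)))\<^sup>2)}"

definition Knorm :: "('h::real_normed_vector) Kelem \<Rightarrow> real" where
  "Knorm x = sqrt ((norm (fst x))\<^sup>2 +
     (\<Sum>n. (norm (fst (snd x n)))\<^sup>2 + (norm (snd (snd x n)))\<^sup>2))"

definition Kadd :: "('h::complex_vector) Kelem \<Rightarrow> 'h Kelem \<Rightarrow> 'h Kelem" where
  "Kadd x y = (fst x + fst y, \<lambda>n. (fst (snd x n) + fst (snd y n), snd (snd x n) + snd (snd y n)))"

definition Kscale :: "complex \<Rightarrow> ('h::complex_vector) Kelem \<Rightarrow> 'h Kelem" where
  "Kscale c x = (scaleC c (fst x), \<lambda>n. (scaleC c (fst (snd x n)), scaleC c (snd (snd x n))))"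

definition Kzero :: "('h::complex_vector) Kelem" where
  "Kzero = (0, \<lambda>n. (0, 0))"

definition Kdiff :: "('h::complex_vector) Kelem \<Rightarrow> 'h Kelem \<Rightarrow> 'h Kelem" where
  "Kdiff x y = Kadd x (Kscale (-1) y)"

definition Kemb :: "'h::complex_vector \<Rightarrow> 'h Kelem" where
  "Kemb h = (h, \<lambda>n. (0, 0))"

definition PH :: "('h::complex_vector) Kelem \<Rightarrow> 'h Kelem" where
  "PH x = Kemb (fst x)"

inductive_set Kspan :: "('h::complex_vector) Kelem set \<Rightarrow> 'h Kelem set" for S where
  zero: "Kzero \<in> Kspan S"
| add: "x \<in> S \<Longrightarrow> y \<in> Kspan S \<Longrightarrow> Kadd (Kscale c x) y \<in> Kspan S"

definition Kclosure :: "('h::{complex_vector,real_normed_vector}) Kelem set \<Rightarrow> 'h Kelem set" where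
  "Kclosure A = {x \<in> Kspace. \<forall>e>0. \<exists>y\<in>A. Knorm (Kdiff x y) < e}"

definition Kisometry :: "(('h::{complex_vector,real_normed_vector}) Kelem \<Rightarrow> 'h Kelem) \<Rightarrow> bool" where
  "Kisometry V \<longleftrightarrow> V ` Kspace \<subseteq> Kspace \<and>
     (\<forall>x\<in>Kspace. \<forall>y\<in>Kspace. V (Kadd x y) = Kadd (V x) (V y)) \<and>
     (\<forall>c. \<forall>x\<in>Kspace. V (Kscale c x) = Kscale c (V x)) \<and>
     (\<forall>x\<in>Kspace. Knorm (V x) = Knorm x)"

end

theory Submission
  imports Defs
begin

text \<open>Write \<open>D\<^sub>i = (1 - T\<^sub>i\<^sup>* T\<^sub>i)\<^sup>1\<^sup>/\<^sup>2\<close>, which is invertible because \<open>T\<^sub>i\<close> is a strict contraction.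
  By commutativity \<open>\<parallel>D\<^sub>1 T\<^sub>2 h\<parallel>\<^sup>2 + \<parallel>D\<^sub>2 h\<parallel>\<^sup>2 = \<parallel>D\<^sub>1 h\<parallel>\<^sup>2 + \<parallel>D\<^sub>2 T\<^sub>1 h\<parallel>\<^sup>2\<close>, and the isometry
  \<open>(D\<^sub>1 T\<^sub>2 h, D\<^sub>2 h) \<mapsto> (D\<^sub>1 h, D\<^sub>2 T\<^sub>1 h)\<close> extends to a unitary \<open>U\<close> of \<open>H \<oplus> H\<close>, since the orthogonal
  complement of either side is a graph over \<open>H\<close>, hence a copy of \<open>H\<close>. Let \<open>S\<^sub>1\<close> and \<open>S\<^sub>2\<close> act on
  \<open>(h, (a\<^sub>n, b\<^sub>n)\<^sub>n)\<close> by \<open>T\<^sub>1\<close>, resp. \<open>T\<^sub>2\<close>, on \<open>h\<close> and by the shift that inserts \<open>D\<^sub>1 h\<close> into the sequence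
  \<open>a\<close>, resp. \<open>D\<^sub>2 h\<close> into \<open>b\<close>. With \<open>U\<close> acting on each term of the sequence, \<open>V\<^sub>1 = S\<^sub>1 U\<close> and
  \<open>V\<^sub>2 = U\<^sup>-\<^sup>1 S\<^sub>2\<close> are commuting isometries with product
  \<open>(h, f) \<mapsto> (T\<^sub>1 T\<^sub>2 h, (D\<^sub>1 T\<^sub>2 h, D\<^sub>2 h), f\<^sub>0, f\<^sub>1, \<dots>)\<close>. They act on the first component as \<open>T\<^sub>1\<close> and \<open>T\<^sub>2\<close>,
  which gives the dilation property. As \<open>D\<^sub>1\<close> and \<open>D\<^sub>2\<close> are onto, the orbit of \<open>H\<close> spans
  the zeroth copy of \<open>H \<oplus> H\<close>, and applying \<open>V\<^sub>1 V\<^sub>2\<close> moves it to every other copy.\<close>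

text \<open>Operator spaces inherit completeness from a \<open>banach\<close> codomain; the square
  root is later found there by a fixed-point argument.\<close>

instance chilbert_space \<subseteq> banach ..

section \<open>Complex structure on pairs, and complex-linear maps\<close>

instantiation prod :: (complex_vector, complex_vector) complex_vector
begin

definition scaleC_prod :: "complex \<Rightarrow> 'a \<times> 'b \<Rightarrow> 'a \<times> 'b" where
  "scaleC_prod c x = (scaleC c (fst x), scaleC c (snd x))"

instance
  by standard
    (simp_all add: scaleC_prod_def scaleR_prod_def scaleC_add_right scaleC_add_left
      scaleC_scaleC scaleC_one scaleR_scaleC)

end

lemma scaleC_Pair [simp]: "scaleC c (a, b) = (scaleC c a, scaleC c b)"
  and fst_scaleC [simp]: "fst (scaleC c x) = scaleC c (fst x)"
  and snd_scaleC [simp]: "snd (scaleC c x) = scaleC c (snd x)"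
  by (simp_all add: scaleC_prod_def)

lemma scaleC_zero_right [simp]: "scaleC c (0::'a::complex_vector) = 0"
  by (metis add_cancel_right_right scaleC_add_right)

lemma scaleC_zero_left [simp]: "scaleC 0 (x::'a::complex_vector) = 0"
  using scaleR_scaleC[of 0 x] by simp

lemma scaleC_diff_right: "scaleC c (x - y) = scaleC c x - scaleC c (y::'a::complex_vector)"
  by (metis add_diff_cancel_right' diff_add_cancel scaleC_add_right)

lemma scaleC_minus_one: "scaleC (-1) x = - (x::'a::complex_vector)"
  using scaleR_scaleC[of "-1" x] by simp

lemma clinear_add: "clinear f \<Longrightarrow> f (x + y) = f x + f y"
  and clinear_scaleC: "clinear f \<Longrightarrow> f (scaleC c x) = scaleC c (f x)"
  by (auto simp: clinear_def)

lemma clinear_scaleR: "clinear f \<Longrightarrow> f (r *\<^sub>R x) = r *\<^sub>R f x"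
  by (simp add: scaleR_scaleC clinear_scaleC)

lemma clinear_linear: "clinear f \<Longrightarrow> linear f"
  by (intro linearI) (auto simp: clinear_add clinear_scaleR)

lemma clinear_zero: "clinear f \<Longrightarrow> f 0 = 0"
  by (simp add: clinear_linear linear_0)

lemma clinear_compose: "clinear f \<Longrightarrow> clinear g \<Longrightarrow> clinear (\<lambda>x. f (g x))"
  by (simp add: clinear_def)

lemma clinear_inv:
  assumes "clinear f" and "bij f"
  shows "clinear (inv f)"
  unfolding clinear_def
proof (intro conjI allI)
  have *: "f (inv f y) = y" for y
    using assms(2) by (simp add: bij_is_surj surj_f_inv_f)
  show "inv f (x + y) = inv f x + inv f y" for x y
    using assms by (intro inv_f_eq) (auto simp: bij_is_inj clinear_add *)
  show "inv f (scaleC c x) = scaleC c (inv f x)" for c x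
    using assms by (intro inv_f_eq) (auto simp: bij_is_inj clinear_scaleC *)
qed

lemma bounded_clinear_opI:
  assumes "clinear T" and "\<And>x. norm (T x) \<le> K * norm x"
  shows "bounded_clinear_op T"
  using assms unfolding bounded_clinear_op_def by (auto simp: mult.commute)

lemma bounded_clinear_op_clinear: "bounded_clinear_op T \<Longrightarrow> clinear T"
  by (simp add: bounded_clinear_op_def)

lemma bounded_clinear_op_bounded_linear: "bounded_clinear_op T \<Longrightarrow> bounded_linear T"
  unfolding bounded_clinear_op_def
  by (auto intro!: bounded_linear_intro simp: clinear_add clinear_scaleR)

lemma bounded_clinear_op_compose:
  assumes "bounded_clinear_op S" and "bounded_clinear_op T"
  shows "bounded_clinear_op (\<lambda>x. S (T x))"
  using bounded_linear_compose[OF assms[THEN bounded_clinear_op_bounded_linear]] assms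
  by (auto simp: bounded_clinear_op_def clinear_compose bounded_linear.bounded)

section \<open>Complex inner products\<close>

lemma cinner_add_right: "cinner x (y + z) = cinner x y + cinner x (z::'a::complex_inner)"
  by (metis cinner_add_left cinner_commute complex_cnj_add)

lemma cinner_scaleC_right: "cinner x (scaleC r y) = r * cinner x (y::'a::complex_inner)"
  by (metis cinner_commute cinner_scaleC_left complex_cnj_cnj complex_cnj_mult)

lemma Re_cinner_self: "Re (cinner x x) = (norm (x::'a::complex_inner))\<^sup>2"
  using cinner_ge_zero[of x] by (simp add: norm_eq_sqrt_cinner)

lemma cinner_self: "cinner x x = of_real ((norm (x::'a::complex_inner))\<^sup>2)"
  using cinner_commute[of x x] by (simp add: complex_eq_iff Re_cinner_self)

lemma Re_cinner_commute: "Re (cinner x y) = Re (cinner y (x::'a::complex_inner))"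
  by (subst cinner_commute) simp

lemma norm_scaleC: "norm (scaleC c x) = cmod c * norm (x::'a::complex_inner)"
proof -
  have "(norm (scaleC c x))\<^sup>2 = Re ((c * cnj c) * cinner x x)"
    by (simp only: Re_cinner_self[symmetric] cinner_scaleC_left cinner_scaleC_right ac_simps)
  also have "\<dots> = (cmod c * norm x)\<^sup>2"
    unfolding complex_norm_square[symmetric] cinner_self
    by (simp only: of_real_mult[symmetric] of_real_power[symmetric] Re_complex_of_real
        power_mult_distrib)
  finally show ?thesis by simp
qed

lemma semidefinite_form_Cauchy_Schwarz:
  fixes b :: "'a::real_vector \<Rightarrow> 'a \<Rightarrow> real"
  assumes lin: "\<And>x. linear (b x)" and sym: "\<And>x y. b x y = b y x" and nn: "\<And>x. 0 \<le> b x x"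
  shows "(b x y)\<^sup>2 \<le> b x x * b y y"
proof -
  have q: "0 \<le> b x x + 2 * t * b x y + t\<^sup>2 * b y y" for t
  proof -
    have "b (x + t *\<^sub>R y) (x + t *\<^sub>R y) = b (x + t *\<^sub>R y) x + t * b (x + t *\<^sub>R y) y"
      by (simp add: linear_add[OF lin] linear_scale[OF lin])
    also have "\<dots> = b x x + 2 * t * b x y + t\<^sup>2 * b y y"
      by (simp add: sym[of "x + t *\<^sub>R y" x] sym[of "x + t *\<^sub>R y" y] linear_add[OF lin]
          linear_scale[OF lin] sym[of y x] distrib_left power2_eq_square)
    finally show ?thesis using nn by metis
  qed
  show ?thesis
  proof (cases "b y y = 0")
    case True
    have "b x y = 0"
    proof (rule ccontr)
      assume "b x y \<noteq> 0"
      \<comment> \<open>For \<open>b y y = 0\<close> the quadratic is affine in \<open>t\<close>,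
        and this \<open>t\<close> gives it the value -1.\<close>
      then show False
        using q[of "- (b x x + 1) / (2 * b x y)"] True by (simp add: field_simps)
    qed
    then show ?thesis using nn by simp
  next
    case False
    then have "b y y > 0" using nn[of y] by simp
    then show ?thesis
      using q[of "- b x y / b y y"] by (simp add: field_simps power2_eq_square)
  qed
qed

lemma abs_Re_cinner_le: "\<bar>Re (cinner x y)\<bar> \<le> norm x * norm (y::'a::complex_inner)"
proof -
  have sR: "cinner x (r *\<^sub>R y) = of_real r * cinner x y" for x y :: 'a and r
    by (simp add: scaleR_scaleC cinner_scaleC_right)
  have "(Re (cinner x y))\<^sup>2 \<le> Re (cinner x x) * Re (cinner y y)"
    by (rule semidefinite_form_Cauchy_Schwarz)
      (auto simp: cinner_ge_zero cinner_add_right sR intro!: linearI Re_cinner_commute)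
  then have "(Re (cinner x y))\<^sup>2 \<le> (norm x * norm y)\<^sup>2"
    by (simp add: Re_cinner_self power_mult_distrib)
  then show ?thesis by (simp add: abs_le_square_iff[symmetric])
qed

lemma bounded_bilinear_cinner:
  "bounded_bilinear (cinner :: 'a::complex_inner \<Rightarrow> 'a \<Rightarrow> complex)"
proof -
  have sR: "cinner x (r *\<^sub>R y) = r *\<^sub>R cinner x y" "cinner (r *\<^sub>R x) y = r *\<^sub>R cinner x y"
    for x y :: 'a and r
    by (simp_all add: scaleR_scaleC cinner_scaleC_right cinner_scaleC_left scaleR_conv_of_real)
  \<comment> \<open>Up to sign, the imaginary part is the real part against
    \<open>scaleC \<i> y\<close>.\<close>
  have im: "\<bar>Im (cinner x y)\<bar> \<le> norm x * norm y" for x y :: 'a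
    using abs_Re_cinner_le[of x "scaleC \<i> y"] by (simp add: norm_scaleC cinner_scaleC_right)
  have "norm (cinner x y) \<le> norm x * norm y * 2" for x y :: 'a
    using cmod_le[of "cinner x y"] abs_Re_cinner_le[of x y] im[of x y] by linarith
  then show ?thesis
    by (intro bounded_bilinear.intro)
      (auto simp: cinner_add_left cinner_add_right sR)
qed

interpretation cinner: bounded_bilinear "cinner :: 'a::complex_inner \<Rightarrow> 'a \<Rightarrow> complex"
  by (rule bounded_bilinear_cinner)

lemma cinner_ext:
  assumes "\<And>z. cinner x z = cinner y (z::'a::complex_inner)"
  shows "x = y"
  using assms[of "x - y"] cinner_eq_zero_iff[of "x - y"] by (simp add: cinner.diff_left)

lemma power2_norm_add:
  "(norm (x + y))\<^sup>2 = (norm x)\<^sup>2 + 2 * Re (cinner x y) + (norm (y::'a::complex_inner))\<^sup>2"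
  using Re_cinner_commute[of y x]
  by (simp add: Re_cinner_self[symmetric] cinner_add_left cinner_add_right)

lemma power2_norm_diff:
  "(norm (x - y))\<^sup>2 = (norm x)\<^sup>2 - 2 * Re (cinner x y) + (norm (y::'a::complex_inner))\<^sup>2"
  using power2_norm_add[of x "- y"] by (simp add: cinner.minus_right)

section \<open>Adjoints and square roots\<close>

text \<open>The representing vector is the minimiser of the functional \<open>J\<close>, which is
  bounded below by \<open>- K\<^sup>2\<close>; the vanishing first variation at the minimiser is the
  desired identity for real parts.\<close>

lemma Riesz_representation:
  fixes \<phi> :: "'h::chilbert_space \<Rightarrow> complex"
  assumes add: "\<And>x y. \<phi> (x + y) = \<phi> x + \<phi> y"
    and scale: "\<And>c x. \<phi> (scaleC c x) = c * \<phi> x"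
    and bound: "\<And>x. norm (\<phi> x) \<le> K * norm x"
  obtains a where "\<And>x. \<phi> x = cinner a x"
proof -
  define J where "J = (\<lambda>x. (norm x)\<^sup>2 - 2 * Re (\<phi> x))"
  have \<phi>R: "\<phi> (r *\<^sub>R x) = r *\<^sub>R \<phi> x" for r x
    by (simp add: scaleR_scaleC scale scaleR_conv_of_real)
  have blin: "bounded_linear \<phi>"
    by (rule bounded_linear_intro[where K = K]) (use bound in \<open>auto simp: add \<phi>R mult.commute\<close>)
  have Jlow: "- K\<^sup>2 \<le> J x" for x
  proof -
    have "Re (\<phi> x) \<le> K * norm x"
      using bound[of x] complex_Re_le_cmod[of "\<phi> x"] by linarith
    moreover have "0 \<le> (norm x - K)\<^sup>2" by simp
    ultimately show ?thesis
      unfolding J_def power2_diff by (simp add: algebra_simps)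
  qed
  define m where "m = Inf (range J)"
  have bdd: "bdd_below (range J)"
    using Jlow by (auto intro!: bdd_belowI)
  have m_le: "m \<le> J x" for x
    unfolding m_def using bdd by (intro cInf_lower) auto
  have "\<exists>x. J x < m + inverse (real (Suc n))" for n
    using cInf_lessD[of "range J" "m + inverse (real (Suc n))"] by (auto simp: m_def)
  then obtain s where s: "\<And>n. J (s n) < m + inverse (real (Suc n))"
    by metis
  \<comment> \<open>The parallelogram law, with \<open>J\<close> at the midpoint bounded below by
    \<open>m\<close>; it makes minimising sequences Cauchy.\<close>
  have para: "(norm (x - y))\<^sup>2 \<le> 2 * (J x - m) + 2 * (J y - m)" for x y
  proof -
    have "J ((1/2) *\<^sub>R (x + y)) = (norm (x + y))\<^sup>2 / 4 - Re (\<phi> x) - Re (\<phi> y)"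
      by (simp add: J_def \<phi>R add power_divide) (simp add: field_simps)
    then have "m \<le> (norm (x + y))\<^sup>2 / 4 - Re (\<phi> x) - Re (\<phi> y)"
      using m_le by metis
    then show ?thesis
      using power2_norm_add[of x y] power2_norm_diff[of x y]
      by (simp add: J_def field_simps)
  qed
  have "Cauchy s"
  proof (rule metric_CauchyI)
    fix e :: real assume "0 < e"
    then obtain N where N: "inverse (real (Suc N)) < e\<^sup>2 / 4"
      using reals_Archimedean[of "e\<^sup>2 / 4"] by auto
    have "dist (s i) (s j) < e" if "N \<le> i" "N \<le> j" for i j
    proof -
      have "J (s k) - m < e\<^sup>2 / 4" if "N \<le> k" for k
      proof -
        have "inverse (real (Suc k)) \<le> inverse (real (Suc N))"
          using that by (simp add: field_simps)
        then show ?thesis using s[of k] N by linarith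
      qed
      from this[OF that(1)] this[OF that(2)] para[of "s i" "s j"]
      have "(norm (s i - s j))\<^sup>2 < e\<^sup>2"
        by (simp add: field_simps)
      then show ?thesis
        using \<open>0 < e\<close> by (simp add: dist_norm power2_less_imp_less)
    qed
    then show "\<exists>M. \<forall>i\<ge>M. \<forall>j\<ge>M. dist (s i) (s j) < e" by blast
  qed
  then obtain a where a: "s \<longlonglongrightarrow> a"
    using Cauchy_convergent_iff convergent_def by blast
  have "(\<lambda>n. J (s n)) \<longlonglongrightarrow> J a"
    unfolding J_def by (intro tendsto_intros a bounded_linear.tendsto[OF blin])
  moreover have "(\<lambda>n. m + inverse (real (Suc n))) \<longlonglongrightarrow> m + 0"
    by (intro tendsto_intros LIMSEQ_inverse_real_of_nat)
  ultimately have Ja: "J a \<le> m"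
    using s by (intro LIMSEQ_le[of _ "J a" _ "m"]) (auto intro: less_imp_le)
  have Re_eq: "Re (cinner a x) = Re (\<phi> x)" for x
  proof -
    define d where "d = Re (cinner a x) - Re (\<phi> x)"
    have q: "0 \<le> 2 * t * d + t\<^sup>2 * (norm x)\<^sup>2" for t
    proof -
      have "J (a + t *\<^sub>R x) = J a + 2 * t * d + t\<^sup>2 * (norm x)\<^sup>2"
        by (simp add: J_def d_def power2_norm_add add \<phi>R cinner.scaleR_right power_mult_distrib
            algebra_simps)
      then show ?thesis using m_le[of "a + t *\<^sub>R x"] Ja by linarith
    qed
    \<comment> \<open>At \<open>t = - d * u\<close> the quadratic equals
      \<open>- (d\<^sup>2 * (u + u\<^sup>2))\<close>. The summand 1 in the denominator covers
      \<open>x = 0\<close>.\<close>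
    define u where "u = 1 / ((norm x)\<^sup>2 + 1)"
    have "0 < u" and u: "u * (norm x)\<^sup>2 = 1 - u"
      using add_nonneg_pos[of "(norm x)\<^sup>2" 1] by (auto simp: u_def field_simps)
    have "2 * (- d * u) * d + (- d * u)\<^sup>2 * (norm x)\<^sup>2 = - 2 * d\<^sup>2 * u + d\<^sup>2 * u * (u * (norm x)\<^sup>2)"
      by (simp add: power2_eq_square)
    also have "\<dots> = - (d\<^sup>2 * (u + u\<^sup>2))"
      unfolding u by (simp add: power2_eq_square algebra_simps)
    finally have "d\<^sup>2 * (u + u\<^sup>2) \<le> 0"
      using q[of "- d * u"] by linarith
    moreover have "0 < u + u\<^sup>2"
      using \<open>0 < u\<close> by (simp add: add_pos_pos)
    ultimately have "d = 0"
      by (simp add: mult_le_0_iff)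
    then show ?thesis by (simp add: d_def)
  qed
  have "\<phi> x = cinner a x" for x
  proof (rule complex_eqI)
    show "Re (\<phi> x) = Re (cinner a x)" by (simp add: Re_eq)
    show "Im (\<phi> x) = Im (cinner a x)"
      using Re_eq[of "scaleC \<i> x"] by (simp add: cinner_scaleC_right scale)
  qed
  then show thesis by (rule that)
qed

text \<open>\<open>S x\<close> is the Riesz vector of \<open>\<lambda>y. cinner x (T y)\<close>. Its
  uniqueness gives linearity, and taking \<open>y = S x\<close> gives the bound.\<close>

lemma adjoint_exists:
  fixes T :: "'h::chilbert_space \<Rightarrow> 'h"
  assumes "bounded_clinear_op T"
  obtains S where "bounded_clinear_op S" and "\<And>x y. cinner (S x) y = cinner x (T y)"
proof -
  note lin = bounded_clinear_op_clinear[OF assms]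
  obtain K where K: "\<And>x. norm (T x) \<le> norm x * K" and "0 \<le> K"
    using bounded_linear.nonneg_bounded[OF bounded_clinear_op_bounded_linear[OF assms]] by blast
  obtain L where L: "\<And>x y. norm (cinner x (y::'h)) \<le> norm x * norm y * L" and "0 \<le> L"
    using cinner.nonneg_bounded by blast
  have "\<exists>a. \<forall>y. cinner x (T y) = cinner a y" for x
  proof -
    have "norm (cinner x (T y)) \<le> norm x * K * L * norm y" for y
    proof -
      have "norm (cinner x (T y)) \<le> norm x * norm (T y) * L" by (rule L)
      also have "\<dots> \<le> norm x * (norm y * K) * L"
        using K \<open>0 \<le> L\<close> by (intro mult_right_mono mult_left_mono) auto
      finally show ?thesis by (simp add: ac_simps)
    qed
    then show ?thesis
      using Riesz_representation[of "\<lambda>y. cinner x (T y)"]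
      by (metis clinear_add[OF lin] clinear_scaleC[OF lin] cinner_add_right cinner_scaleC_right)
  qed
  then obtain S where S: "\<And>x y. cinner x (T y) = cinner (S x) y"
    by metis
  have "clinear S"
    unfolding clinear_def
  proof (intro conjI allI)
    show "S (x + y) = S x + S y" for x y
      by (rule cinner_ext) (simp add: S[symmetric] cinner_add_left)
    show "S (scaleC c x) = scaleC c (S x)" for c x
      by (rule cinner_ext) (simp add: S[symmetric] cinner_scaleC_left)
  qed
  moreover have "norm (S x) \<le> K * norm x" for x
  proof (cases "S x = 0")
    case False
    have "(norm (S x))\<^sup>2 = Re (cinner x (T (S x)))"
      by (simp add: S Re_cinner_self)
    also have "\<dots> \<le> norm x * norm (T (S x))"
      using abs_Re_cinner_le[of x "T (S x)"] by linarith
    also have "\<dots> \<le> norm x * (norm (S x) * K)"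
      using K by (intro mult_left_mono) auto
    finally show ?thesis using False by (simp add: power2_eq_square mult.commute)
  qed (use \<open>0 \<le> K\<close> in simp)
  ultimately show thesis
    using S by (intro that[of S] bounded_clinear_opI) auto
qed

definition selfadjoint :: "('h::complex_inner \<Rightarrow> 'h) \<Rightarrow> bool" where
  "selfadjoint R \<longleftrightarrow> (\<forall>x y. cinner (R x) y = cinner x (R y))"

lemma selfadjointD: "selfadjoint R \<Longrightarrow> cinner (R x) y = cinner x (R y)"
  by (simp add: selfadjoint_def)

text \<open>Moving \<open>R\<close> to the other side of the inner product yields linearity, so the
  definition states the symmetry alone.\<close>

lemma selfadjoint_clinear:
  assumes "selfadjoint R"
  shows "clinear R"
  unfolding clinear_def
proof (intro conjI allI)
  show "R (x + y) = R x + R y" for x y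
    by (rule cinner_ext) (simp add: selfadjointD[OF assms] cinner_add_left)
  show "R (scaleC c x) = scaleC c (R x)" for c x
    by (rule cinner_ext) (simp add: selfadjointD[OF assms] cinner_scaleC_left)
qed

text \<open>Cauchy-Schwarz for the positive form \<open>Re (cinner (R x) y)\<close>, at the vectors
  \<open>x\<close> and \<open>R x\<close>, upgrades a bound on the quadratic form to a norm
  bound.\<close>

lemma selfadjoint_norm_le:
  fixes R :: "'h::complex_inner \<Rightarrow> 'h"
  assumes R: "selfadjoint R" and "0 \<le> q"
    and nonneg: "\<And>x. 0 \<le> Re (cinner (R x) x)" and le: "\<And>x. Re (cinner (R x) x) \<le> q * (norm x)\<^sup>2"
  shows "norm (R x) \<le> q * norm x"
proof (cases "R x = 0")
  case False
  have "((norm (R x))\<^sup>2)\<^sup>2 = (Re (cinner (R x) (R x)))\<^sup>2"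
    by (simp add: Re_cinner_self)
  also have "\<dots> \<le> Re (cinner (R x) x) * Re (cinner (R (R x)) (R x))"
  proof (rule semidefinite_form_Cauchy_Schwarz[OF _ _ nonneg])
    show "linear (\<lambda>y. Re (cinner (R x) y))" for x
      by (auto simp: cinner_add_right cinner.scaleR_right intro!: linearI)
    show "Re (cinner (R x) y) = Re (cinner (R y) x)" for x y
      unfolding selfadjointD[OF R, of x y] by (rule Re_cinner_commute)
  qed
  also have "\<dots> \<le> (q * (norm x)\<^sup>2) * (q * (norm (R x))\<^sup>2)"
    using nonneg le \<open>0 \<le> q\<close> by (intro mult_mono) auto
  also have "\<dots> = (q * norm x)\<^sup>2 * (norm (R x))\<^sup>2"
    by (simp add: power2_eq_square)
  finally have "(norm (R x))\<^sup>2 * (norm (R x))\<^sup>2 \<le> (q * norm x)\<^sup>2 * (norm (R x))\<^sup>2"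
    by (simp only: power2_eq_square[of "(norm (R x))\<^sup>2"])
  then have "(norm (R x))\<^sup>2 \<le> (q * norm x)\<^sup>2"
    by (rule mult_right_le_imp_le) (use False in simp)
  then show ?thesis
    by (rule power2_le_imp_le) (use \<open>0 \<le> q\<close> in simp)
qed (use \<open>0 \<le> q\<close> in simp)

text \<open>The square root of \<open>1 - X\<close> is \<open>1 - Y\<close>, where \<open>Y\<close> is the fixed point of the contraction
  \<open>Y \<mapsto> (X + Y\<^sup>2) / 2\<close> on the ball of radius \<open>\<parallel>X\<parallel> < 1\<close>.\<close>

lemma selfadjoint_sqrt_one_minus:
  fixes X :: "'h::chilbert_space \<Rightarrow> 'h"
  assumes X: "selfadjoint X" and q: "0 \<le> q" "q < 1" and bound: "\<And>x. norm (X x) \<le> q * norm x"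
  obtains D where "selfadjoint D" and "\<And>x. D (D x) = x - X x" and "bij D"
proof -
  define X' where "X' = Blinfun X"
  have "bounded_linear X"
    using bound by (intro bounded_clinear_op_bounded_linear bounded_clinear_opI
        selfadjoint_clinear X) auto
  then have X': "blinfun_apply X' = X"
    by (simp add: X'_def bounded_linear_Blinfun_apply)
  have nX: "norm X' \<le> q"
    using q bound by (intro norm_blinfun_bound) (auto simp: X')
  \<comment> \<open>Self-adjointness is built into this closed set, so that the fixed point has
    it.\<close>
  define S where "S = {Y :: 'h \<Rightarrow>\<^sub>L 'h. norm Y \<le> q \<and> selfadjoint (blinfun_apply Y)}"
  define F where "F = (\<lambda>Y :: 'h \<Rightarrow>\<^sub>L 'h. (1/2) *\<^sub>R (X' + (Y o\<^sub>L Y)))"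
  have "closed S"
  proof -
    have "S = cball 0 q \<inter> (\<Inter>x. \<Inter>y. {Y. cinner (blinfun_apply Y x) y = cinner x (blinfun_apply Y y)})"
      by (auto simp: S_def selfadjoint_def)
    also have "closed \<dots>"
      by (intro closed_Int closed_cball closed_INT ballI closed_Collect_eq
          cinner.continuous_on continuous_intros)
    finally show ?thesis .
  qed
  then have "complete S" by (simp add: complete_eq_closed)
  moreover have "S \<noteq> {}"
    using q by (auto simp: S_def selfadjoint_def cinner.zero_left cinner.zero_right intro!: exI[of _ 0])
  moreover have "F ` S \<subseteq> S"
  proof (intro image_subsetI)
    fix Y assume "Y \<in> S"
    then have Y: "norm Y \<le> q" "selfadjoint (blinfun_apply Y)" by (auto simp: S_def)
    have "norm (Y o\<^sub>L Y) \<le> norm Y * norm Y" by (rule norm_blinfun_compose)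
    also have "\<dots> \<le> 1 * q" using Y q by (intro mult_mono) auto
    finally have "norm (X' + (Y o\<^sub>L Y)) \<le> 2 * q"
      using nX norm_triangle_ineq[of X' "Y o\<^sub>L Y"] by linarith
    then show "F Y \<in> S"
      using selfadjointD[OF X] selfadjointD[OF Y(2)]
      by (simp add: S_def F_def selfadjoint_def X' blinfun.bilinear_simps cinner_add_left
          cinner_add_right cinner.scaleR_left cinner.scaleR_right)
  qed
  moreover have "dist (F Y) (F Z) \<le> q * dist Y Z" if "Y \<in> S" "Z \<in> S" for Y Z
  proof -
    have YZ: "norm Y \<le> q" "norm Z \<le> q" using that by (auto simp: S_def)
    \<comment> \<open>This splitting of the difference of squares is valid for noncommuting
      \<open>Y\<close> and \<open>Z\<close>.\<close>
    have "F Y - F Z = (1/2) *\<^sub>R ((Y o\<^sub>L (Y - Z)) + ((Y - Z) o\<^sub>L Z))"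
      by (rule blinfun_eqI) (simp add: F_def blinfun.bilinear_simps algebra_simps)
    moreover have "norm (Y o\<^sub>L (Y - Z)) \<le> q * norm (Y - Z)"
      by (rule order_trans[OF norm_blinfun_compose]) (use YZ in \<open>auto intro: mult_right_mono\<close>)
    moreover have "norm ((Y - Z) o\<^sub>L Z) \<le> q * norm (Y - Z)"
      by (rule order_trans[OF norm_blinfun_compose])
        (use YZ in \<open>auto intro: mult_left_mono simp: mult.commute[of q]\<close>)
    ultimately show ?thesis
      using norm_triangle_ineq[of "Y o\<^sub>L (Y - Z)" "(Y - Z) o\<^sub>L Z"] by (simp add: dist_norm)
  qed
  ultimately obtain Y where "Y \<in> S" "F Y = Y"
    using Banach_fix[of S q F] q by blast
  then have nY: "norm Y \<le> q" and sY: "selfadjoint (blinfun_apply Y)" by (auto simp: S_def)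
  define D where "D = (\<lambda>x. x - blinfun_apply Y x)"
  have "selfadjoint D"
    using selfadjointD[OF sY] by (simp add: selfadjoint_def D_def cinner.diff_left cinner.diff_right)
  moreover have "D (D x) = x - X x" for x
  proof -
    have "X x + blinfun_apply Y (blinfun_apply Y x) = 2 *\<^sub>R blinfun_apply (F Y) x"
      by (simp add: F_def blinfun.bilinear_simps X')
    also have "\<dots> = blinfun_apply Y x + blinfun_apply Y x" by (simp add: \<open>F Y = Y\<close> scaleR_2)
    finally show ?thesis
      by (simp add: D_def blinfun.bilinear_simps algebra_simps)
  qed
  \<comment> \<open>\<open>D x = z\<close> says that \<open>x\<close> is a fixed point of the
    contraction \<open>x \<mapsto> z + Y x\<close>.\<close>
  moreover have "\<exists>!x. D x = z" for z
  proof -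
    have "dist (z + blinfun_apply Y x) (z + blinfun_apply Y y) \<le> q * dist x y" for x y
      using norm_blinfun[of Y "x - y"] mult_right_mono[OF nY, of "norm (x - y)"]
      by (simp add: dist_norm blinfun.bilinear_simps)
    then have "\<exists>!x. z + blinfun_apply Y x = x"
      using q by (intro banach_fix_type) auto
    then show ?thesis by (simp add: D_def diff_eq_eq eq_commute[of _ "z + _"])
  qed
  then have "bij D" by (metis bij_iff)
  ultimately show thesis by (rule that)
qed

text \<open>Dividing by \<open>C\<close> reduces to \<open>1 - X\<close> with
  \<open>X = 1 - R / C\<close>, whose form lies between 0 and \<open>1 - c / C < 1\<close> times the
  squared norm. The lower bound \<open>c\<close> makes the inverse of the root bounded.\<close>

lemma selfadjoint_positive_sqrt:
  fixes R :: "'h::chilbert_space \<Rightarrow> 'h"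
  assumes R: "selfadjoint R" and c: "0 < c" "c \<le> C"
    and lower: "\<And>x. c * (norm x)\<^sup>2 \<le> Re (cinner (R x) x)"
    and upper: "\<And>x. Re (cinner (R x) x) \<le> C * (norm x)\<^sup>2"
  obtains D where "bounded_clinear_op D" and "selfadjoint D" and "\<And>x. D (D x) = R x" and "bij D"
    and "bounded_clinear_op (inv D)"
proof -
  define X where "X = (\<lambda>x. x - (1 / C) *\<^sub>R R x)"
  have "0 < C" using c by simp
  have X: "selfadjoint X"
    using selfadjointD[OF R] by (simp add: selfadjoint_def X_def cinner.diff_left cinner.diff_right
        cinner.scaleR_left cinner.scaleR_right)
  have Q: "Re (cinner (X x) x) = (norm x)\<^sup>2 - Re (cinner (R x) x) / C" for x
    by (simp add: X_def cinner.diff_left cinner.scaleR_left Re_cinner_self)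
  have q: "0 \<le> 1 - c / C" "1 - c / C < 1" using c by (auto simp: field_simps)
  have "norm (X x) \<le> (1 - c / C) * norm x" for x
  proof (rule selfadjoint_norm_le[OF X q(1)])
    show "0 \<le> Re (cinner (X x) x)" for x
      using upper[of x] \<open>0 < C\<close> by (simp add: Q field_simps)
    show "Re (cinner (X x) x) \<le> (1 - c / C) * (norm x)\<^sup>2" for x
      using lower[of x] \<open>0 < C\<close> by (simp add: Q field_simps)
  qed
  then obtain E where E: "selfadjoint E" "\<And>x. E (E x) = x - X x" "bij E"
    using selfadjoint_sqrt_one_minus[OF X q] by metis
  note linE = clinear_scaleR[OF selfadjoint_clinear[OF E(1)]]
  define D where "D = (\<lambda>x. sqrt C *\<^sub>R E x)"
  have D: "selfadjoint D"
    using selfadjointD[OF E(1)]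
    by (simp add: selfadjoint_def D_def cinner.scaleR_left cinner.scaleR_right)
  have DD: "D (D x) = R x" for x
    using \<open>0 < C\<close> by (simp add: D_def linE E(2) X_def)
  have nD: "(norm (D x))\<^sup>2 = Re (cinner (R x) x)" for x
    using selfadjointD[OF D, of "D x" x] by (simp add: DD Re_cinner_self)
  have "bij (\<lambda>x. sqrt C *\<^sub>R x :: 'h)"
    using \<open>0 < C\<close> by (intro bij_betw_byWitness[where f' = "\<lambda>x. (1 / sqrt C) *\<^sub>R x"]) auto
  then have "bij D"
    using bij_comp[OF E(3)] by (simp add: D_def comp_def)
  have lin: "clinear D" using D by (rule selfadjoint_clinear)
  have "norm (D x) \<le> sqrt C * norm x" for x
    using upper[of x] \<open>0 < C\<close> by (intro power2_le_imp_le[of "norm (D x)"]) (auto simp: nD power_mult_distrib)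
  then have bD: "bounded_clinear_op D" using lin by (rule bounded_clinear_opI[rotated])
  have low: "sqrt c * norm x \<le> norm (D x)" for x
    using lower[of x] \<open>0 < c\<close> by (intro power2_le_imp_le[of "sqrt c * norm x"]) (auto simp: nD power_mult_distrib)
  have "norm (inv D y) \<le> (1 / sqrt c) * norm y" for y
    using low[of "inv D y"] \<open>0 < c\<close> \<open>bij D\<close>
    by (simp add: field_simps bij_is_surj surj_f_inv_f)
  then have "bounded_clinear_op (inv D)"
    using clinear_inv[OF lin \<open>bij D\<close>] by (rule bounded_clinear_opI[rotated])
  with bD D DD \<open>bij D\<close> show thesis by (rule that)
qed

section \<open>Defect operators and unitaries\<close>

lemma power2_norm_prod: "(norm z)\<^sup>2 = (norm (fst z))\<^sup>2 + (norm (snd z))\<^sup>2"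
  by (simp add: norm_prod_def)

text \<open>\<open>D\<close> is the square root of \<open>1 - T\<^sup>* T\<close>. Strictness of the
  contraction bounds this operator below by \<open>1 - (onorm T)\<^sup>2 > 0\<close>, hence the
  bounded inverse.\<close>

lemma strict_contraction_defect:
  fixes T :: "'h::chilbert_space \<Rightarrow> 'h"
  assumes T: "bounded_clinear_op T" and less: "onorm T < 1"
  obtains D where "bounded_clinear_op D" and "bij D" and "bounded_clinear_op (inv D)"
    and "\<And>x. (norm (D x))\<^sup>2 = (norm x)\<^sup>2 - (norm (T x))\<^sup>2"
proof -
  note bl = bounded_clinear_op_bounded_linear[OF T]
  obtain S where S: "\<And>x y. cinner (S x) y = cinner x (T y)"
    using adjoint_exists[OF T] by metis
  define R where "R = (\<lambda>x. x - S (T x))"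
  have "selfadjoint R"
  proof -
    have "cinner x (S (T y)) = cinner (T x) (T y)" for x y
      using cinner_commute[of x "S (T y)"] cinner_commute[of "T x" "T y"] by (simp add: S)
    then show ?thesis
      by (simp add: selfadjoint_def R_def cinner.diff_left cinner.diff_right S)
  qed
  have Q: "Re (cinner (R x) x) = (norm x)\<^sup>2 - (norm (T x))\<^sup>2" for x
    by (simp add: R_def cinner.diff_left S Re_cinner_self)
  have "0 \<le> onorm T" using bl by (rule onorm_pos_le)
  then have c: "0 < 1 - (onorm T)\<^sup>2" "1 - (onorm T)\<^sup>2 \<le> 1"
    using less by (auto simp: power_less_one_iff)
  have lower: "(1 - (onorm T)\<^sup>2) * (norm x)\<^sup>2 \<le> Re (cinner (R x) x)" for x
    using power_mono[OF onorm[OF bl, of x] norm_ge_zero, of 2]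
    by (simp add: Q power_mult_distrib left_diff_distrib)
  have upper: "Re (cinner (R x) x) \<le> 1 * (norm x)\<^sup>2" for x
    by (simp add: Q)
  obtain D where D: "bounded_clinear_op D" "selfadjoint D" "\<And>x. D (D x) = R x" "bij D"
    "bounded_clinear_op (inv D)"
    using selfadjoint_positive_sqrt[OF \<open>selfadjoint R\<close> c lower upper] by metis
  have "(norm (D x))\<^sup>2 = (norm x)\<^sup>2 - (norm (T x))\<^sup>2" for x
    using selfadjointD[OF D(2), of "D x" x] by (simp add: D(3) Re_cinner_self flip: Q)
  with D show thesis by (intro that)
qed

text \<open>The range of \<open>h \<mapsto> (A h, B h)\<close> is the graph \<open>{(C k, k)}\<close> of \<open>C = A B\<^sup>-\<^sup>1\<close>; its orthogonal complement
  is \<open>{(g, - C\<^sup>* g)}\<close>, which \<open>g = (1 + C C\<^sup>*)\<^sup>-\<^sup>1\<^sup>/\<^sup>2 a\<close> parametrises isometrically by \<open>a\<close>.\<close>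

lemma graph_plus_complement:
  fixes A B :: "'h::chilbert_space \<Rightarrow> 'h"
  assumes A: "bounded_clinear_op A" and B: "bounded_clinear_op B"
    and bijB: "bij B" and invB: "bounded_clinear_op (inv B)"
  obtains \<Phi> :: "'h \<times> 'h \<Rightarrow> 'h \<times> 'h" where "clinear \<Phi>" and "bij \<Phi>" and "\<And>h. \<Phi> (h, 0) = (A h, B h)"
    and "\<And>h a. (norm (\<Phi> (h, a)))\<^sup>2 = (norm (A h))\<^sup>2 + (norm (B h))\<^sup>2 + (norm a)\<^sup>2"
proof -
  define C where "C = (\<lambda>k. A (inv B k))"
  have BinvB: "B (inv B k) = k" and invBB: "inv B (B k) = k" for k
    using bijB by (auto simp: bij_is_surj surj_f_inv_f bij_is_inj)
  have CB: "C (B h) = A h" for h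
    by (simp add: C_def invBB)
  have C: "bounded_clinear_op C"
    unfolding C_def by (rule bounded_clinear_op_compose[OF A invB])
  obtain S where bS: "bounded_clinear_op S" and S: "\<And>x y. cinner (S x) y = cinner x (C y)"
    using adjoint_exists[OF C] by metis
  note lin = bounded_clinear_op_clinear[OF A] bounded_clinear_op_clinear[OF B]
    bounded_clinear_op_clinear[OF C] bounded_clinear_op_clinear[OF bS]
  \<comment> \<open>As \<open>S\<close> is the adjoint of \<open>C\<close>, this is
    \<open>1 + C C\<^sup>*\<close>; below, \<open>F\<close> is its square root and \<open>G\<close>
    the inverse of \<open>F\<close>.\<close>
  define R where "R = (\<lambda>x. x + C (S x))"
  have CS: "cinner (C (S x)) y = cinner (S x) (S y)" for x y
    using cinner_commute[of "C (S x)" y] cinner_commute[of "S y" "S x"] by (simp flip: S)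
  have "selfadjoint R"
    by (simp add: selfadjoint_def R_def cinner_add_left cinner_add_right CS) (simp add: S)
  have Q: "Re (cinner (R x) x) = (norm x)\<^sup>2 + (norm (S x))\<^sup>2" for x
    by (simp add: R_def cinner_add_left CS Re_cinner_self)
  obtain K where K: "\<And>x. norm (S x) \<le> norm x * K"
    using bS by (auto simp: bounded_clinear_op_def)
  have "(1::real) \<le> 1 + K\<^sup>2" by simp
  moreover have "1 * (norm x)\<^sup>2 \<le> Re (cinner (R x) x)" for x
    by (simp add: Q)
  moreover have "Re (cinner (R x) x) \<le> (1 + K\<^sup>2) * (norm x)\<^sup>2" for x
    using power_mono[OF K[of x] norm_ge_zero, of 2]
    by (simp add: Q power_mult_distrib algebra_simps)
  ultimately obtain F where F: "selfadjoint F" "\<And>x. F (F x) = R x" "bij F"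
    using selfadjoint_positive_sqrt[OF \<open>selfadjoint R\<close> zero_less_one] by metis
  define G where "G = inv F"
  have linG: "clinear G"
    unfolding G_def by (rule clinear_inv[OF selfadjoint_clinear[OF F(1)] F(3)])
  have FG: "F (G a) = a" for a
    using F(3) by (simp add: G_def bij_is_surj surj_f_inv_f)
  define \<Phi> where "\<Phi> = (\<lambda>(h, a). (A h + G a, B h - S (G a)))"
  have lin\<Phi>: "clinear \<Phi>"
    by (auto simp: clinear_def \<Phi>_def clinear_add[OF lin(1)] clinear_add[OF lin(2)]
        clinear_add[OF lin(4)] clinear_add[OF linG] clinear_scaleC[OF lin(1)]
        clinear_scaleC[OF lin(2)] clinear_scaleC[OF lin(4)] clinear_scaleC[OF linG]
        scaleC_add_right scaleC_diff_right)
  have norm\<Phi>: "(norm (\<Phi> (h, a)))\<^sup>2 = (norm (A h))\<^sup>2 + (norm (B h))\<^sup>2 + (norm a)\<^sup>2" for h a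
  proof -
    \<comment> \<open>Orthogonality of the graph and its complement: the cross terms cancel.\<close>
    have "cinner (S (G a)) (B h) = cinner (G a) (A h)"
      by (simp add: S CB)
    then have "Re (cinner (B h) (S (G a))) = Re (cinner (A h) (G a))"
      by (metis Re_cinner_commute)
    moreover have "(norm (G a))\<^sup>2 + (norm (S (G a)))\<^sup>2 = (norm a)\<^sup>2"
      using selfadjointD[OF F(1), of a "G a"] by (simp add: FG Re_cinner_self flip: Q F(2))
    ultimately show ?thesis
      by (simp add: \<Phi>_def power2_norm_prod power2_norm_add power2_norm_diff)
  qed
  have "inj \<Phi>"
  proof -
    have "z = 0" if "\<Phi> z = 0" for z
    proof -
      obtain h a where z: "z = (h, a)" by force
      have "(norm (A h))\<^sup>2 + (norm (B h))\<^sup>2 + (norm a)\<^sup>2 = 0"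
        using norm\<Phi>[of h a] that by (simp add: z)
      then have "B h = 0" "a = 0"
        by (auto simp: add_nonneg_eq_0_iff)
      then show ?thesis
        using invBB[of h] clinear_zero[OF bounded_clinear_op_clinear[OF invB]]
        by (simp add: z zero_prod_def)
    qed
    then show ?thesis
      by (simp add: linear_injective_0[OF clinear_linear[OF lin\<Phi>]])
  qed
  moreover have "surj \<Phi>"
  proof (rule surjI)
    fix z
    \<comment> \<open>To solve \<open>\<Phi> (h, a) = z\<close>, apply \<open>C\<close> to the
      second equation and eliminate \<open>A h\<close>: what remains is
      \<open>R (G a) = fst z - C (snd z)\<close>, and \<open>R (G a) = F a\<close>.\<close>
    define a where "a = G (fst z - C (snd z))"
    have "R (G a) = fst z - C (snd z)"
      by (simp add: F(2)[symmetric] FG a_def)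
    then have "G a + C (S (G a)) = fst z - C (snd z)" by (simp add: R_def)
    then have "\<Phi> (inv B (snd z + S (G a)), a) = z"
      by (simp add: \<Phi>_def prod_eq_iff BinvB clinear_add[OF lin(3)] algebra_simps flip: C_def[THEN fun_cong])
    then show "\<Phi> (inv B (snd z + S (G (G (fst z - C (snd z))))), G (fst z - C (snd z))) = z"
      by (simp only: a_def)
  qed
  ultimately have "bij \<Phi>" by (simp add: bij_def)
  moreover have "\<Phi> (h, 0) = (A h, B h)" for h
    by (simp add: \<Phi>_def clinear_zero[OF linG] clinear_zero[OF lin(4)])
  ultimately show thesis
    using lin\<Phi> norm\<Phi> by (intro that)
qed

text \<open>Both complements are parametrised by the same \<open>'h\<close>, so
  \<open>\<Psi>\<close> after the inverse of \<open>\<Phi>\<close> matches graph with graph and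
  complement with complement.\<close>

lemma unitary_between_graphs:
  fixes A B A' B' :: "'h::chilbert_space \<Rightarrow> 'h"
  assumes "bounded_clinear_op A" "bounded_clinear_op B" "bij B" "bounded_clinear_op (inv B)"
    and "bounded_clinear_op A'" "bounded_clinear_op B'" "bij B'" "bounded_clinear_op (inv B')"
    and eq: "\<And>h. (norm (A h))\<^sup>2 + (norm (B h))\<^sup>2 = (norm (A' h))\<^sup>2 + (norm (B' h))\<^sup>2"
  obtains U :: "'h \<times> 'h \<Rightarrow> 'h \<times> 'h" where "clinear U" and "bij U" and "\<And>z. norm (U z) = norm z"
    and "\<And>h. U (A h, B h) = (A' h, B' h)"
proof -
  obtain \<Phi> :: "'h \<times> 'h \<Rightarrow> 'h \<times> 'h" where \<Phi>: "clinear \<Phi>" "bij \<Phi>" "\<And>h. \<Phi> (h, 0) = (A h, B h)"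
    "\<And>h a. (norm (\<Phi> (h, a)))\<^sup>2 = (norm (A h))\<^sup>2 + (norm (B h))\<^sup>2 + (norm a)\<^sup>2"
    using graph_plus_complement[OF assms(1-4)] by blast
  obtain \<Psi> :: "'h \<times> 'h \<Rightarrow> 'h \<times> 'h" where \<Psi>: "clinear \<Psi>" "bij \<Psi>" "\<And>h. \<Psi> (h, 0) = (A' h, B' h)"
    "\<And>h a. (norm (\<Psi> (h, a)))\<^sup>2 = (norm (A' h))\<^sup>2 + (norm (B' h))\<^sup>2 + (norm a)\<^sup>2"
    using graph_plus_complement[OF assms(5-8)] by blast
  define U where "U = (\<lambda>z. \<Psi> (inv \<Phi> z))"
  have U\<Phi>: "U (\<Phi> z) = \<Psi> z" for z
    using \<Phi>(2) by (simp add: U_def bij_is_inj)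
  have "norm (U z) = norm z" for z
  proof -
    obtain h a where z: "z = \<Phi> (h, a)"
      using \<Phi>(2) by (metis bij_pointE surj_pair)
    have "(norm (U z))\<^sup>2 = (norm z)\<^sup>2"
      unfolding z U\<Phi> by (simp add: \<Phi>(4) \<Psi>(4) eq)
    then show ?thesis by simp
  qed
  moreover have "U (A h, B h) = (A' h, B' h)" for h
    by (simp add: U\<Phi> flip: \<Phi>(3) \<Psi>(3))
  moreover have "bij U"
    using bij_comp[OF bij_imp_bij_inv[OF \<Phi>(2)] \<Psi>(2)] by (simp add: U_def comp_def)
  moreover have "clinear U"
    unfolding U_def by (rule clinear_compose[OF \<Psi>(1) clinear_inv[OF \<Phi>(1,2)]])
  ultimately show thesis by (intro that)
qed

section \<open>The dilation space\<close>

lemma Kspace_iff: "x \<in> Kspace \<longleftrightarrow> summable (\<lambda>n. (norm (snd x n))\<^sup>2)"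
  by (cases x) (simp add: Kspace_def power2_norm_prod)

lemma Knorm_eq: "Knorm x = sqrt ((norm (fst x))\<^sup>2 + (\<Sum>n. (norm (snd x n))\<^sup>2))"
  by (simp add: Knorm_def power2_norm_prod)

lemma Kadd_eq: "Kadd x y = (fst x + fst y, \<lambda>n. snd x n + snd y n)"
  by (simp add: Kadd_def plus_prod_def)

lemma Kscale_eq: "Kscale c x = (scaleC c (fst x), \<lambda>n. scaleC c (snd x n))"
  by (simp add: Kscale_def scaleC_prod_def)

lemma Kdiff_eq: "Kdiff x y = (fst x - fst y, \<lambda>n. snd x n - snd y n)"
  by (simp add: Kdiff_def Kadd_eq Kscale_eq scaleC_minus_one)

lemma Kemb_eq: "Kemb h = (h, \<lambda>n. 0)"
  by (simp add: Kemb_def zero_prod_def)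

lemma Kzero_eq: "Kzero = Kemb 0"
  by (simp add: Kzero_def Kemb_def)

lemma Kemb_in_Kspace: "Kemb h \<in> Kspace"
  by (simp add: Kspace_iff Kemb_eq)

lemma Kscale_zero: "Kscale 0 x = Kzero"
  by (simp add: Kscale_eq Kzero_eq Kemb_eq scaleC_prod_def zero_prod_def)

lemma Kscale_in_Kspace: "x \<in> Kspace \<Longrightarrow> Kscale c x \<in> (Kspace :: 'h::complex_inner Kelem set)"
proof -
  have "(norm (scaleC c z))\<^sup>2 = (cmod c)\<^sup>2 * (norm z)\<^sup>2" for z :: "'h \<times> 'h"
    by (simp add: power2_norm_prod norm_scaleC power_mult_distrib distrib_left)
  then show "x \<in> Kspace \<Longrightarrow> Kscale c x \<in> (Kspace :: 'h Kelem set)"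
    by (simp add: Kspace_iff Kscale_eq summable_mult)
qed

lemma Kadd_in_Kspace:
  assumes "x \<in> Kspace" and "y \<in> Kspace"
  shows "Kadd x y \<in> Kspace"
proof -
  have "(norm (u + v))\<^sup>2 \<le> 2 * (norm u)\<^sup>2 + 2 * (norm v)\<^sup>2" for u v :: "'a \<times> 'a"
  proof -
    have "(norm (u + v))\<^sup>2 \<le> (norm u + norm v)\<^sup>2"
      by (intro power_mono norm_triangle_ineq) simp
    also have "\<dots> \<le> 2 * (norm u)\<^sup>2 + 2 * (norm v)\<^sup>2"
      using zero_le_power2[of "norm u - norm v"] by (simp add: power2_sum power2_diff)
    finally show ?thesis .
  qed
  then have le: "norm ((norm (snd (Kadd x y) n))\<^sup>2) \<le> 2 * (norm (snd x n))\<^sup>2 + 2 * (norm (snd y n))\<^sup>2" for n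
    by (simp add: Kadd_eq)
  have sum: "summable (\<lambda>n. 2 * (norm (snd x n))\<^sup>2 + 2 * (norm (snd y n))\<^sup>2)"
    using assms by (intro summable_add summable_mult) (auto simp: Kspace_iff)
  show ?thesis
    unfolding Kspace_iff using le by (intro summable_comparison_test'[OF sum, of 0]) simp
qed

lemma Kisometry_in_Kspace: "Kisometry V \<Longrightarrow> x \<in> Kspace \<Longrightarrow> V x \<in> Kspace"
  by (auto simp: Kisometry_def)

lemma Kisometry_funpow_in_Kspace: "Kisometry V \<Longrightarrow> x \<in> Kspace \<Longrightarrow> (V ^^ n) x \<in> Kspace"
  by (induction n) (auto simp: Kisometry_in_Kspace)

lemma Kisometry_compose:
  assumes "Kisometry V" and "Kisometry W"
  shows "Kisometry (\<lambda>x. V (W x))"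
  using assms by (auto simp: Kisometry_def image_subset_iff)

definition Kmap :: "('h \<times> 'h \<Rightarrow> 'h \<times> 'h) \<Rightarrow> 'h Kelem \<Rightarrow> 'h Kelem" where
  "Kmap U x = (fst x, \<lambda>n. U (snd x n))"

lemma Kisometry_Kmap:
  assumes "clinear U" and "\<And>z. norm (U z) = norm z"
  shows "Kisometry (Kmap U)"
  by (auto simp: Kisometry_def Kmap_def Kspace_iff Knorm_eq Kadd_eq Kscale_eq assms(2)
      clinear_add[OF assms(1)] clinear_scaleC[OF assms(1)])

text \<open>A shift of the second entries is obtained by conjugation with
  \<open>Kmap prod.swap\<close>, so this one form serves both \<open>V1\<close> and
  \<open>V2\<close>.\<close>

definition Kshift :: "('h \<Rightarrow> 'h) \<Rightarrow> ('h \<Rightarrow> 'h) \<Rightarrow> 'h Kelem \<Rightarrow> 'h Kelem" where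
  "Kshift T D x =
    (T (fst x), \<lambda>n. (case n of 0 \<Rightarrow> D (fst x) | Suc m \<Rightarrow> fst (snd x m), snd (snd x n)))"

text \<open>The inserted \<open>D h\<close> restores exactly the squared norm lost in passing from
  \<open>h\<close> to \<open>T h\<close>.\<close>

lemma Kisometry_Kshift:
  assumes T: "clinear T" and D: "clinear D"
    and eq: "\<And>h. (norm (D h))\<^sup>2 = (norm h)\<^sup>2 - (norm (T h))\<^sup>2"
  shows "Kisometry (Kshift T D)"
proof -
  have *: "Kshift T D x \<in> Kspace \<and> Knorm (Kshift T D x) = Knorm x" if "x \<in> Kspace" for x
  proof -
    obtain h f where x: "x = (h, f)" by force
    define a where "a = (\<lambda>n. (norm (fst (f n)))\<^sup>2)"
    define b where "b = (\<lambda>n. (norm (snd (f n)))\<^sup>2)"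
    define a' where "a' = (\<lambda>n. case n of 0 \<Rightarrow> (norm (D h))\<^sup>2 | Suc m \<Rightarrow> a m)"
    have sum: "summable (\<lambda>n. a n + b n)"
      using that by (simp add: Kspace_iff power2_norm_prod x a_def b_def)
    have a: "summable a" and b: "summable b"
      by (rule summable_comparison_test'[OF sum, of 0]; simp add: a_def b_def)+
    have a': "a' sums ((\<Sum>n. a n) + (norm (D h))\<^sup>2)"
      using summable_sums[OF a] sums_Suc_iff[of a' "\<Sum>n. a n"] by (simp add: a'_def)
    have shift: "(\<lambda>n. (norm (snd (Kshift T D x) n))\<^sup>2) = (\<lambda>n. a' n + b n)"
      by (auto simp: fun_eq_iff Kshift_def x power2_norm_prod a'_def a_def b_def split: nat.split)
    have "(\<lambda>n. a' n + b n) sums ((\<Sum>n. a n) + (norm (D h))\<^sup>2 + (\<Sum>n. b n))"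
      by (rule sums_add[OF a' summable_sums[OF b]])
    moreover have "(\<Sum>n. (norm (snd x n))\<^sup>2) = (\<Sum>n. a n) + (\<Sum>n. b n)"
      by (simp add: suminf_add[OF a b]) (simp add: x power2_norm_prod a_def b_def)
    ultimately show ?thesis
      unfolding Kspace_iff Knorm_eq shift by (simp add: sums_iff eq) (simp add: x Kshift_def)
  qed
  show ?thesis
    unfolding Kisometry_def
  proof (intro conjI ballI allI image_subsetI)
    show "Kshift T D (Kadd x y) = Kadd (Kshift T D x) (Kshift T D y)" for x y
      by (auto simp: Kshift_def Kadd_eq clinear_add[OF T] clinear_add[OF D] split: nat.split)
    show "Kshift T D (Kscale c x) = Kscale c (Kshift T D x)" for c x
      by (auto simp: Kshift_def Kscale_eq clinear_scaleC[OF T] clinear_scaleC[OF D] split: nat.split)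
  qed (use * in blast)+
qed

section \<open>Spans and density in the dilation space\<close>

lemma Kspan_add_mem: "x \<in> Kspan S \<Longrightarrow> y \<in> Kspan S \<Longrightarrow> Kadd x y \<in> Kspan S"
proof (induction rule: Kspan.induct)
  case zero
  then show ?case by (simp add: Kzero_eq Kadd_eq Kemb_eq)
next
  case (add x z c)
  then have "Kadd (Kscale c x) (Kadd z y) \<in> Kspan S"
    by (intro Kspan.add) auto
  then show ?case by (simp add: Kadd_eq add.assoc)
qed

lemma Kspan_scale_mem: "x \<in> Kspan S \<Longrightarrow> Kscale c x \<in> Kspan S"
proof (induction rule: Kspan.induct)
  case zero
  then show ?case using Kspan.zero by (simp add: Kzero_eq Kscale_eq Kemb_eq)
next
  case (add x z d)
  then have "Kadd (Kscale (c * d) x) (Kscale c z) \<in> Kspan S"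
    by (intro Kspan.add) auto
  then show ?case by (simp add: Kadd_eq Kscale_eq scaleC_add_right scaleC_scaleC)
qed

lemma Kspan_superset: "x \<in> S \<Longrightarrow> x \<in> Kspan S"
  using Kspan.add[OF _ Kspan.zero, of x S 1] by (simp add: Kzero_eq Kadd_eq Kscale_eq Kemb_eq scaleC_one)

lemma Kspan_diff_mem: "x \<in> Kspan S \<Longrightarrow> y \<in> Kspan S \<Longrightarrow> Kdiff x y \<in> Kspan S"
  by (simp add: Kdiff_def Kspan_add_mem Kspan_scale_mem)

lemma Kspan_invariant:
  fixes V :: "'h::complex_inner Kelem \<Rightarrow> 'h Kelem"
  assumes V: "Kisometry V" and "S \<subseteq> Kspace" and image: "V ` S \<subseteq> S" and "x \<in> Kspan S"
  shows "V x \<in> Kspan S"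
proof -
  \<comment> \<open>\<open>V\<close> is linear on \<open>Kspace\<close> only, so the induction
    carries membership along.\<close>
  have "x \<in> Kspace \<and> V x \<in> Kspan S"
    using \<open>x \<in> Kspan S\<close>
  proof (induction rule: Kspan.induct)
    case zero
    have "V Kzero = V (Kscale 0 Kzero)"
      by (simp add: Kscale_zero)
    also have "\<dots> = Kzero"
      using V Kemb_in_Kspace[of 0] unfolding Kisometry_def Kzero_eq
      by (metis (no_types, lifting) Kscale_zero Kzero_eq)
    finally show ?case using Kspan.zero[of S] Kemb_in_Kspace[of "0::'h"] by (simp add: Kzero_eq)
  next
    case (add x y c)
    then have K: "x \<in> Kspace" "Kscale c x \<in> Kspace" "y \<in> Kspace"
      using \<open>S \<subseteq> Kspace\<close> by (auto intro: Kscale_in_Kspace)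
    then have "V (Kadd (Kscale c x) y) = Kadd (Kscale c (V x)) (V y)"
      using V by (simp add: Kisometry_def)
    moreover have "Kadd (Kscale c (V x)) (V y) \<in> Kspan S"
      using add image by (intro Kspan.add) auto
    ultimately show ?case
      using K by (simp add: Kadd_in_Kspace)
  qed
  then show ?thesis ..
qed

text \<open>Truncations of \<open>x\<close> are finite sums of the given vectors, and the squared
  error is the tail of a convergent series.\<close>

lemma Kspan_dense:
  fixes S :: "'h::complex_inner Kelem set"
  assumes emb: "\<And>h. Kemb h \<in> Kspan S"
    and unit: "\<And>n e. (0, \<lambda>k. if k = n then e else 0) \<in> Kspan S"
  shows "Kspace = Kclosure (Kspan S)"
proof (intro equalityI subsetI)
  fix x :: "'h Kelem" assume x: "x \<in> Kspace"
  define y where "y = (\<lambda>N. (fst x, \<lambda>n. if n < N then snd x n else 0))"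
  have y: "y N \<in> Kspan S" for N
  proof (induction N)
    case 0
    then show ?case using emb[of "fst x"] by (simp add: y_def Kemb_eq)
  next
    case (Suc N)
    have "y (Suc N) = Kadd (y N) (0, \<lambda>k. if k = N then snd x N else 0)"
      by (auto simp: y_def Kadd_eq fun_eq_iff less_Suc_eq)
    then show ?case by (simp add: Suc Kspan_add_mem unit)
  qed
  have "\<exists>z\<in>Kspan S. Knorm (Kdiff x z) < e" if "0 < e" for e
  proof -
    define g where "g = (\<lambda>n. (norm (snd x n))\<^sup>2)"
    have g: "summable g" using x by (simp add: Kspace_iff g_def)
    obtain N where N: "norm (\<Sum>n. g (n + N)) < e\<^sup>2"
      using suminf_exist_split[OF _ g, of "e\<^sup>2"] \<open>0 < e\<close> by auto
    have "(\<lambda>n. if n < N then 0 else g n) sums (\<Sum>n. g (n + N))"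
      by (subst sums_zero_iff_shift[symmetric, of N])
        (use summable_sums[OF summable_ignore_initial_segment[OF g, of N]] in \<open>auto simp: sums_zero_iff_shift\<close>)
    moreover have "(norm (snd (Kdiff x (y N)) n))\<^sup>2 = (if n < N then 0 else g n)" for n
      by (simp add: Kdiff_eq y_def g_def)
    ultimately have "Knorm (Kdiff x (y N)) = sqrt (\<Sum>n. g (n + N))"
      unfolding Knorm_eq by (simp add: sums_iff) (simp add: Kdiff_eq y_def)
    also have "\<dots> < e"
      using N \<open>0 < e\<close> by (intro real_less_lsqrt) auto
    finally show ?thesis using y by blast
  qed
  then show "x \<in> Kclosure (Kspan S)"
    using x by (simp add: Kclosure_def)
qed (simp add: Kclosure_def)

section \<open>The dilation\<close>

lemma fst_funpow:
  fixes V :: "'a \<times> 'b \<Rightarrow> 'a \<times> 'b"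
  assumes "\<And>x. fst (V x) = T (fst x)"
  shows "fst ((V ^^ n) x) = (T ^^ n) (fst x)"
  by (induction n) (simp_all add: assms)

theorem theorem2p1:
  fixes T1 T2 :: "'h::chilbert_space \<Rightarrow> 'h"
  assumes "bounded_clinear_op T1" and "bounded_clinear_op T2"
    and "\<forall>x. T1 (T2 x) = T2 (T1 x)"
    and "onorm T1 < 1" and "onorm T2 < 1"
  shows "\<exists>V1 V2 :: 'h Kelem \<Rightarrow> 'h Kelem.
           Kisometry V1 \<and> Kisometry V2 \<and>
           (\<forall>x\<in>Kspace. V1 (V2 x) = V2 (V1 x)) \<and>
           (\<forall>h s1 s2. PH ((V1 ^^ s1) ((V2 ^^ s2) (Kemb h))) = Kemb ((T1 ^^ s1) ((T2 ^^ s2) h))) \<and>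
           Kspace = Kclosure (Kspan {(V1 ^^ s1) ((V2 ^^ s2) (Kemb h)) | h s1 s2. True})"
proof -
  have comm: "T2 (T1 x) = T1 (T2 x)" for x using assms(3) by simp
  note lin1 = bounded_clinear_op_clinear[OF assms(1)] and lin2 = bounded_clinear_op_clinear[OF assms(2)]
  obtain D1 where D1: "bounded_clinear_op D1" "bij D1" "bounded_clinear_op (inv D1)"
    "\<And>x. (norm (D1 x))\<^sup>2 = (norm x)\<^sup>2 - (norm (T1 x))\<^sup>2"
    using strict_contraction_defect[OF assms(1,4)] by blast
  obtain D2 where D2: "bounded_clinear_op D2" "bij D2" "bounded_clinear_op (inv D2)"
    "\<And>x. (norm (D2 x))\<^sup>2 = (norm x)\<^sup>2 - (norm (T2 x))\<^sup>2"
    using strict_contraction_defect[OF assms(2,5)] by blast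
  note linD = bounded_clinear_op_clinear[OF D1(1)] bounded_clinear_op_clinear[OF D2(1)]
  have A: "bounded_clinear_op (\<lambda>h. D1 (T2 h))" "bounded_clinear_op (\<lambda>h. D2 (T1 h))"
    using bounded_clinear_op_compose D1(1) D2(1) assms(1,2) by blast+
  \<comment> \<open>Both sides equal the squared norm of \<open>h\<close> minus that of
    \<open>T1 (T2 h)\<close>. The right-hand pair is reversed because
    \<open>unitary_between_graphs\<close> wants the second map of each pair bijective.\<close>
  have eq: "(norm (D1 (T2 h)))\<^sup>2 + (norm (D2 h))\<^sup>2 = (norm (D2 (T1 h)))\<^sup>2 + (norm (D1 h))\<^sup>2" for h
    by (simp add: D1(4) D2(4) comm)
  obtain U0 :: "'h \<times> 'h \<Rightarrow> 'h \<times> 'h" where U0: "clinear U0" "bij U0" "\<And>z. norm (U0 z) = norm z"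
    "\<And>h. U0 (D1 (T2 h), D2 h) = (D2 (T1 h), D1 h)"
    using unitary_between_graphs[OF A(1) D2(1-3) A(2) D1(1-3) eq] by blast
  have swap: "clinear (prod.swap :: 'h \<times> 'h \<Rightarrow> _)" "\<And>z :: 'h \<times> 'h. norm (prod.swap z) = norm z"
    by (auto simp: clinear_def norm_prod_def add.commute)
  \<comment> \<open>The swap restores the order: \<open>U\<close> takes
    \<open>(D1 (T2 h), D2 h)\<close> to \<open>(D1 h, D2 (T1 h))\<close>, and \<open>W\<close> is
    its inverse.\<close>
  define U where "U = (\<lambda>z. prod.swap (U0 z))"
  define W where "W = (\<lambda>z. inv U0 (prod.swap z))"
  have WU: "W (U z) = z" and UW: "U (W z) = z" for z
    using U0(2) by (simp_all add: U_def W_def bij_is_inj bij_is_surj surj_f_inv_f)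
  have U: "clinear U" "\<And>z. norm (U z) = norm z"
    using clinear_compose[OF swap(1) U0(1)] by (auto simp: U_def swap(2) U0(3))
  have W: "clinear W" "\<And>z. norm (W z) = norm z"
    using clinear_compose[OF clinear_inv[OF U0(1,2)] swap(1)] U(2)[of "W _"]
    by (simp_all add: W_def[symmetric] UW)
  have W_defect: "W (D1 h, D2 (T1 h)) = (D1 (T2 h), D2 h)" for h
    using WU[of "(D1 (T2 h), D2 h)"] by (simp add: U_def U0(4))
  define V1 where "V1 = (\<lambda>x. Kshift T1 D1 (Kmap U x))"
  \<comment> \<open>The swap that closes the conjugation of the shift is merged with
    \<open>W\<close>.\<close>
  define V2 where "V2 = (\<lambda>x. Kmap (\<lambda>z. W (prod.swap z)) (Kshift T2 D2 (Kmap prod.swap x)))"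
  have V1_eq: "V1 x = (T1 (fst x),
      \<lambda>n. (case n of 0 \<Rightarrow> D1 (fst x) | Suc m \<Rightarrow> fst (U (snd x m)), snd (U (snd x n))))" for x
    by (simp add: V1_def Kshift_def Kmap_def fun_eq_iff split: nat.split)
  have V2_eq: "V2 x = (T2 (fst x),
      \<lambda>n. W (fst (snd x n), case n of 0 \<Rightarrow> D2 (fst x) | Suc m \<Rightarrow> snd (snd x m)))" for x
    by (simp add: V2_def Kshift_def Kmap_def fun_eq_iff split: nat.split)
  have V12: "V1 (V2 x) = (T1 (T2 (fst x)),
      \<lambda>n. case n of 0 \<Rightarrow> (D1 (T2 (fst x)), D2 (fst x)) | Suc m \<Rightarrow> snd x m)" for x
    by (auto simp: V1_eq V2_eq UW fun_eq_iff split: nat.split)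
  \<comment> \<open>In \<open>V2 (V1 x)\<close> the later terms reduce by \<open>WU\<close>; term 0
    is \<open>W_defect\<close>, the property for which \<open>U\<close> was built.\<close>
  have V21: "V2 (V1 x) = V1 (V2 x)" for x
    unfolding V12 by (auto simp: V1_eq V2_eq comm W_defect WU fun_eq_iff split: nat.split)
  have iso1: "Kisometry V1"
    unfolding V1_def
    by (intro Kisometry_compose[OF Kisometry_Kshift Kisometry_Kmap] lin1 linD D1(4) U)
  have WS: "clinear (\<lambda>z. W (prod.swap z))"
    by (rule clinear_compose[OF W(1) swap(1)])
  have iso2: "Kisometry V2"
    unfolding V2_def
    by (intro Kisometry_compose[OF Kisometry_Kmap Kisometry_compose[OF Kisometry_Kshift Kisometry_Kmap]]
        lin2 linD D2(4) WS swap) (simp add: W(2) swap(2))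
  define S where "S = {(V1 ^^ s1) ((V2 ^^ s2) (Kemb h)) | h s1 s2. True}"
  have S_K: "S \<subseteq> Kspace"
    by (auto simp: S_def intro!: Kisometry_funpow_in_Kspace iso1 iso2 Kemb_in_Kspace)
  have S_I: "(V1 ^^ s1) ((V2 ^^ s2) (Kemb h)) \<in> S" for s1 s2 h
    by (auto simp: S_def)
  \<comment> \<open>Moving \<open>V2\<close> past powers of \<open>V1\<close> shows that
    \<open>V1 V2\<close> maps the orbit \<open>S\<close> into itself.\<close>
  have V2_V1_pow: "V2 ((V1 ^^ s) x) = (V1 ^^ s) (V2 x)" for s x
    by (induction s) (simp_all add: V21)
  have "V1 (V2 ((V1 ^^ s1) ((V2 ^^ s2) (Kemb h)))) \<in> S" for s1 s2 h
    using S_I[of "Suc s1" "Suc s2" h] by (simp add: V2_V1_pow)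
  then have V12_S: "(\<lambda>x. V1 (V2 x)) ` S \<subseteq> S"
    by (auto simp: S_def[THEN eqset_imp_iff])
  have emb: "Kemb h \<in> Kspan S" for h
    using S_I[of 0 0 h] by (simp add: Kspan_superset)
  have U0z: "U 0 = 0" using U(1) by (rule clinear_zero)
  have first: "(0, \<lambda>k. if k = 0 then (D1 h, 0) else 0) \<in> Kspan S" for h
  proof -
    have "Kdiff (V1 (Kemb h)) (Kemb (T1 h)) \<in> Kspan S"
      using S_I[of 1 0 h] by (intro Kspan_diff_mem emb Kspan_superset) simp
    also have "Kdiff (V1 (Kemb h)) (Kemb (T1 h)) = (0, \<lambda>k. if k = 0 then (D1 h, 0) else 0)"
      by (auto simp: Kdiff_eq V1_eq Kemb_eq U0z fun_eq_iff prod_eq_iff split: nat.split)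
    finally show ?thesis .
  qed
  have unit: "(0, \<lambda>k. if k = n then e else 0) \<in> Kspan S" for n e
  proof (induction n)
    case 0
    obtain p q where e: "e = (p, q)" by force
    \<comment> \<open>\<open>h\<close> produces the second entry; \<open>V1 (V2 (Kemb h))\<close>
      then has first entry \<open>D1 (T2 h)\<close>, which \<open>g\<close> corrects through
      \<open>first\<close>.\<close>
    obtain h where h: "q = D2 h" using D2(2) by (metis bij_pointE)
    obtain g where g: "p - D1 (T2 h) = D1 g" using D1(2) by (metis bij_pointE)
    have "Kadd (Kdiff (V1 (V2 (Kemb h))) (Kemb (T1 (T2 h)))) (0, \<lambda>k. if k = 0 then (D1 g, 0) else 0)
        \<in> Kspan S"
      using S_I[of 1 1 h] by (intro Kspan_add_mem Kspan_diff_mem emb first Kspan_superset) simp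
    also have "Kadd (Kdiff (V1 (V2 (Kemb h))) (Kemb (T1 (T2 h)))) (0, \<lambda>k. if k = 0 then (D1 g, 0) else 0)
        = (0, \<lambda>k. if k = 0 then e else 0)"
      by (auto simp: Kdiff_eq Kadd_eq V12 Kemb_eq e h fun_eq_iff zero_prod_def simp flip: g split: nat.split)
    finally show ?case .
  next
    case (Suc n)
    \<comment> \<open>The \<open>'h\<close> component is 0, so the product inserts a zero pair and
      acts as a pure shift.\<close>
    have "V1 (V2 (0, \<lambda>k. if k = n then e else 0)) \<in> Kspan S"
      by (rule Kspan_invariant[OF Kisometry_compose[OF iso1 iso2] S_K V12_S Suc])
    also have "V1 (V2 (0, \<lambda>k. if k = n then e else 0)) = (0, \<lambda>k. if k = Suc n then e else 0)"
      by (auto simp: V12 clinear_zero[OF lin1] clinear_zero[OF lin2] clinear_zero[OF linD(1)]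
          clinear_zero[OF linD(2)] fun_eq_iff zero_prod_def split: nat.split)
    finally show ?case .
  qed
  \<comment> \<open>\<open>fst\<close> intertwines each \<open>V\<close> with its \<open>T\<close>,
    and \<open>PH\<close> sees only \<open>fst\<close>; this gives the dilation property.\<close>
  have "fst (V1 x) = T1 (fst x)" "fst (V2 x) = T2 (fst x)" for x
    by (simp_all add: V1_eq V2_eq)
  note fst_funpow[of V1 T1, OF this(1)] fst_funpow[of V2 T2, OF this(2)]
  then have dil: "PH ((V1 ^^ s1) ((V2 ^^ s2) (Kemb h))) = Kemb ((T1 ^^ s1) ((T2 ^^ s2) h))" for h s1 s2
    by (simp add: PH_def Kemb_def)
  show ?thesis
    using iso1 iso2 V21 dil Kspan_dense[OF emb unit] unfolding S_def by (metis (no_types, lifting))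
qed

end
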